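(* Let $H$ be a real Hilbert space, let $\mathsf{A}',\mathsf{B}'$ be maximal monotone operators on $H$ with $S:=\mathsf{A}'^{-1}(0)\cap\mathsf{B}'^{-1}(0)\neq\emptyset$, let $z_0,u\in H$, $(\widetilde{\alpha}_n),(\widetilde{\lambda}_n)\subset(0,1)$, $(\widetilde{\beta}_n),(\widetilde{\mu}_n)\subset(0,+\infty)$, and let $(z_n)$ be given by $$z_{2n+1}=\widetilde{\alpha}_nu+(1-\widetilde{\alpha}_n)J^{\mathsf{A}'}_{\widetilde{\beta}_n}(z_{2n}),\qquad z_{2n+2}=\widetilde{\lambda}_nu+(1-\widetilde{\lambda}_n)J^{\mathsf{B}'}_{\widetilde{\mu}_n}(z_{2n+1})\qquad(n\in\mathbb{N}).$$ Assume $z_n\to x\in H$. Put $\mathsf{A}=\mathsf{B}'$, $\mathsf{B}=\mathsf{A}'$ and, for all $n\in\mathbb{N}$, $\alpha_n=\widetilde{\alpha}_n$, $\lambda_n=\widetilde{\lambda}_n$, $\beta_n=\widetilde{\mu}_n$, $\mu_n=\widetilde{\beta}_{n+1}$, and let $(y_n)$ be given by $y_0=x_0:=J^{\mathsf{A}'}_{\widetilde{\beta}_0}(z_0)$ and $$y_{2n+1}=J^{\mathsf{A}}_{\beta_n}(\alpha_n u+(1-\alpha_n)y_{2n}),\qquad y_{2n+2}=J^{\mathsf{B}}_{\mu_n}(\lambda_n u+(1-\lambda_n)y_{2n+1})\qquad(n\in\mathbb{N}).$$ If $\widetilde{\alpha}_n\to0$ and $\widetilde{\lambda}_n\to0$,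 then $y_n\to x$. Moreover, given rates of convergence $a,\ell:\mathbb{N}\to\mathbb{N}$ for $\widetilde{\alpha}_n\to0$ and $\widetilde{\lambda}_n\to0$, respectively, and $N\in\mathbb{N}$ such that $N\geq\max\{\|u-q\|,\|x_0-q\|,\|q\|\}$ for some $q\in S$, we have that $\|z_{n+1}-y_n\|\to0$ with rate of convergence $$\gamma(k):=2\max\{\widetilde{a}(k),\widetilde{\ell}(k)\}+1,\qquad \widetilde{a}(k):=a(2N(k+1)-1),\quad \widetilde{\ell}(k):=\ell(2N(k+1)-1).$$ If $\rho$ is a rate of metastability for $(z_n)$, then $\widetilde{\rho}$ is a rate of metastability for $(y_n)$, where $$\widetilde{\rho}(k,f):=\max\left\{\rho\left(2k+1,\widetilde{f}[\gamma(4k+3)]+1\right),\gamma(4k+3)\right\}.$$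
   Context: $\mathbb{N}=\{0,1,2,\dots\}$; $[n,p]$ denotes $\{m\in\mathbb{N}:n\leq m\leq p\}$ (empty if $p<n$). For $\gamma>0$, $J^{\mathsf{A}}_\gamma=(I+\gamma\mathsf{A})^{-1}$ is the (single-valued) resolvent of the maximal monotone operator $\mathsf{A}$. Convergence in $H$ is norm convergence. For $f:\mathbb{N}\to\mathbb{N}$ and $M\in\mathbb{N}$, $\widetilde{f}[M](m):=f(\max\{m,M\})$, and $\widetilde{f}[M]+1$ is the function $m\mapsto\widetilde{f}[M](m)+1$. A rate of convergence for a real sequence $a_n\to0$ is $\gamma:\mathbb{N}\to\mathbb{N}$ with $|a_n|\leq\frac1{k+1}$ for all $k$ and all $n\geq\gamma(k)$. A rate of metastability for a sequence $(x_n)$ in $H$ is a functional $\Gamma:\mathbb{N}\times\mathbb{N}^{\mathbb{N}}\to\mathbb{N}$ such that for all $k\in\mathbb{N}$ and $f:\mathbb{N}\to\mathbb{N}$ there is $n\leq\Gamma(k,f)$ with $\|x_i-x_j\|\leq\frac1{k+1}$ for all $i,j\in[n,f(n)]$. In the degenerate case $N=0$, $2N(k+1)-1$ is read as $0$ (truncated subtraction). *)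

theory Defs
  imports "HOL-Analysis.Inner_Product"
begin

definition op_inverse :: "('a \<Rightarrow> 'b set) \<Rightarrow> 'b \<Rightarrow> 'a set" where
  "op_inverse A y = {x. y \<in> A x}"

definition monotone_op :: "('a::real_inner \<Rightarrow> 'a set) \<Rightarrow> bool" where
  "monotone_op A \<longleftrightarrow>
     (\<forall>x y. \<forall>v \<in> A x. \<forall>w \<in> A y. inner (x - y) (v - w) \<ge> 0)"

(* The order on set-valued functions is pointwise inclusion, i.e. inclusion of graphs. *)
definition maximal_monotone :: "('a::real_inner \<Rightarrow> 'a set) \<Rightarrow> bool" where
  "maximal_monotone A \<longleftrightarrow>
     monotone_op A \<and> (\<forall>B. monotone_op B \<and> A \<le> B \<longrightarrow> B = A)"

(* The operator (I + c A)^{-1}, read as a function. By Minty's theorem it is everywhere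
   defined and single-valued when A is maximal monotone on a Hilbert space and c > 0;
   the value is unspecified at points where the underlying set is not a singleton. *)
definition resolvent :: "real \<Rightarrow> ('a::real_inner \<Rightarrow> 'a set) \<Rightarrow> 'a \<Rightarrow> 'a" where
  "resolvent c A x = the_elem (op_inverse (\<lambda>y. {y + c *\<^sub>R v | v. v \<in> A y}) x)"

definition rate_of_convergence_to_0 :: "(nat \<Rightarrow> real) \<Rightarrow> (nat \<Rightarrow> nat) \<Rightarrow> bool" where
  "rate_of_convergence_to_0 s g \<longleftrightarrow>
     (\<forall>k. \<forall>n \<ge> g k. \<bar>s n\<bar> \<le> 1 / (real k + 1))"

definition rate_of_metastability ::
    "(nat \<Rightarrow> 'a::real_normed_vector) \<Rightarrow> (nat \<Rightarrow> (nat \<Rightarrow> nat) \<Rightarrow> nat) \<Rightarrow> bool" where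
  "rate_of_metastability x \<Gamma> \<longleftrightarrow>
     (\<forall>k f. \<exists>n \<le> \<Gamma> k f. \<forall>i \<in> {n..f n}. \<forall>j \<in> {n..f n}.
        norm (x i - x j) \<le> 1 / (real k + 1))"

definition ftilde :: "(nat \<Rightarrow> nat) \<Rightarrow> nat \<Rightarrow> nat \<Rightarrow> nat" where
  "ftilde f M m = f (max m M)"

(* Truncated subtraction on nat is intended: for N = 0 the argument of a is 0. *)
definition shifted_rate :: "nat \<Rightarrow> (nat \<Rightarrow> nat) \<Rightarrow> nat \<Rightarrow> nat" where
  "shifted_rate N a k = a (2 * N * (k + 1) - 1)"

definition gamma_rate :: "nat \<Rightarrow> (nat \<Rightarrow> nat) \<Rightarrow> (nat \<Rightarrow> nat) \<Rightarrow> nat \<Rightarrow> nat" where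
  "gamma_rate N a l k = 2 * max (shifted_rate N a k) (shifted_rate N l k) + 1"

definition rho_tilde ::
    "(nat \<Rightarrow> nat) \<Rightarrow> (nat \<Rightarrow> (nat \<Rightarrow> nat) \<Rightarrow> nat) \<Rightarrow> nat \<Rightarrow> (nat \<Rightarrow> nat) \<Rightarrow> nat" where
  "rho_tilde g \<rho> k f =
     max (\<rho> (2 * k + 1) (\<lambda>m. ftilde f (g (4 * k + 3)) m + 1)) (g (4 * k + 3))"

end

theory Submission
  imports Defs "HOL-Analysis.Convex" "HOL-Analysis.Topology_Euclidean_Space"
begin

text \<open>
  The two iterations interlace: \<open>y n\<close> is exactly the resolvent value computed in the step from
  \<open>z n\<close> to \<open>z (n + 1)\<close>, so \<open>z (n + 1) - y n = c *\<^sub>R (u - y n)\<close> with \<open>c\<close> the current anchoring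
  coefficient. Resolvents do not increase the distance to a common zero \<open>q\<close>, hence
  \<open>norm (u - y n) \<le> 2 * N\<close>, and all quantitative claims follow.

  That resolvents are everywhere defined is Minty's theorem. It is derived by minimising
  \<open>F z + (norm z)\<^sup>2 / 2\<close> over the product space, where \<open>F\<close> is the Fitzpatrick function
  \<open>F (x, v) = (SUP (y, w). inner x w + inner y v - inner y w)\<close>, the supremum being taken over
  the graph of the operator. The minimiser \<open>(x, v)\<close> exists by the parallelogram law and completeness;
  its first-order condition, tested on the graph, puts \<open>(- v, - x)\<close> into the graph by maximality
  and then forces \<open>v = - x\<close>.
\<close>

section \<open>Minimising a convex function plus half the squared norm\<close>

text \<open>A convex function is represented by its epigraph, which avoids infinite values.\<close>

lemma epigraph_regularised_minimum:
  fixes E :: "('b::{real_inner, complete_space} \<times> real) set"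
  assumes "closed E" and "convex E" and "E \<noteq> {}"
    and bound: "\<And>z t. (z, t) \<in> E \<Longrightarrow> c \<le> t + (norm z)\<^sup>2 / 2"
  obtains z0 t0 where "(z0, t0) \<in> E"
    and "\<And>z t. (z, t) \<in> E \<Longrightarrow> t0 + (norm z0)\<^sup>2 / 2 \<le> t + (norm z)\<^sup>2 / 2"
proof -
  define h :: "'b \<times> real \<Rightarrow> real" where "h e = snd e + (norm (fst e))\<^sup>2 / 2" for e
  define m where "m = Inf (h ` E)"
  have bdd: "bdd_below (h ` E)"
    by (rule bdd_belowI[of _ c]) (use bound in \<open>auto simp: h_def\<close>)
  have m_le: "m \<le> h e" if "e \<in> E" for e
    unfolding m_def using bdd that by (simp add: cInf_lower)
  have "\<exists>e\<in>E. h e < m + 1 / (real n + 1)" for n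
  proof -
    have "Inf (h ` E) < m + 1 / (real n + 1)"
      unfolding m_def by simp
    then show ?thesis
      using cInf_lessD[of "h ` E" "m + 1 / (real n + 1)"] assms(3) by auto
  qed
  then obtain e where e: "\<And>n. e n \<in> E" "\<And>n. h (e n) < m + 1 / (real n + 1)"
    by metis
  \<comment> \<open>The midpoint of two near-minimisers lies in \<open>E\<close>; by the
    parallelogram law its value is the mean of theirs minus an eighth of the squared distance, and
    it cannot fall below \<open>m\<close>.\<close>
  have dist_bound: "(norm (fst (e i) - fst (e j)))\<^sup>2
      \<le> 4 * (1 / (real i + 1) + 1 / (real j + 1))" for i j
  proof -
    let ?M = "(1/2) *\<^sub>R e i + (1/2) *\<^sub>R e j"
    have "?M \<in> E"
      by (rule convexD[OF assms(2)]) (use e(1) in auto)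
    then have "m \<le> h ?M"
      by (rule m_le)
    moreover have "h ?M = (h (e i) + h (e j)) / 2 - (norm (fst (e i) - fst (e j)))\<^sup>2 / 8"
      unfolding h_def
      by (simp add: power2_norm_eq_inner inner_add_left inner_add_right inner_diff_left
          inner_diff_right inner_commute field_simps)
    ultimately show ?thesis
      using e(2)[of i] e(2)[of j] by argo
  qed
  have "Cauchy (\<lambda>n. fst (e n))"
  proof (rule metric_CauchyI)
    fix r :: real
    assume "0 < r"
    then obtain M where M: "1 / (real M + 1) < r\<^sup>2 / 8"
      using nat_approx_posE[of "r\<^sup>2 / 8"] by (metis Suc_eq_plus1 of_nat_Suc zero_less_divide_iff
          zero_less_numeral zero_less_power add.commute)
    show "\<exists>M. \<forall>i\<ge>M. \<forall>j\<ge>M. dist (fst (e i)) (fst (e j)) < r"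
    proof (intro exI allI impI)
      fix i j
      assume "M \<le> i" "M \<le> j"
      then have "1 / (real i + 1) \<le> 1 / (real M + 1)" "1 / (real j + 1) \<le> 1 / (real M + 1)"
        by (auto simp: frac_le)
      then have "(norm (fst (e i) - fst (e j)))\<^sup>2 < r\<^sup>2"
        using dist_bound[of i j] M by argo
      then show "dist (fst (e i)) (fst (e j)) < r"
        using \<open>0 < r\<close> by (simp add: dist_norm power2_less_imp_less)
    qed
  qed
  then obtain z0 where z0: "(\<lambda>n. fst (e n)) \<longlonglongrightarrow> z0"
    using Cauchy_convergent_iff convergentD by blast
  have inv: "(\<lambda>n. 1 / (real n + 1)) \<longlonglongrightarrow> 0"
    using LIMSEQ_inverse_real_of_nat by (simp add: inverse_eq_divide add.commute)
  \<comment> \<open>With the base points convergent, convergence of \<open>h (e n)\<close> carries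
    over to the heights \<open>snd (e n)\<close>, and closedness of \<open>E\<close> catches the
    limit.\<close>
  have "(\<lambda>n. h (e n)) \<longlonglongrightarrow> m"
  proof (rule tendsto_sandwich)
    show "\<forall>\<^sub>F n in sequentially. m \<le> h (e n)"
      using m_le e(1) by simp
    show "\<forall>\<^sub>F n in sequentially. h (e n) \<le> m + 1 / (real n + 1)"
      using e(2) by (simp add: less_imp_le)
    show "(\<lambda>n. m + 1 / (real n + 1)) \<longlonglongrightarrow> m"
      using tendsto_add[OF tendsto_const[of m] inv] by simp
  qed simp
  from tendsto_diff[OF this tendsto_divide[OF tendsto_power[OF tendsto_norm[OF z0], of 2]
        tendsto_const[of 2]]]
  have "(\<lambda>n. snd (e n)) \<longlonglongrightarrow> m - (norm z0)\<^sup>2 / 2"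
    by (simp add: h_def)
  with z0 have "(\<lambda>n. (fst (e n), snd (e n))) \<longlonglongrightarrow> (z0, m - (norm z0)\<^sup>2 / 2)"
    by (rule tendsto_Pair)
  then have "(z0, m - (norm z0)\<^sup>2 / 2) \<in> E"
    using closed_sequentially[OF assms(1), of e] e(1) by simp
  moreover have "m - (norm z0)\<^sup>2 / 2 + (norm z0)\<^sup>2 / 2 \<le> t + (norm z)\<^sup>2 / 2"
    if "(z, t) \<in> E" for z t
    using m_le[OF that] by (simp add: h_def)
  ultimately show thesis
    by (rule that)
qed

text \<open>Moving a fraction \<open>s\<close> from the minimiser towards \<open>(z, t)\<close>
  stays in \<open>E\<close> and changes the objective by \<open>s * d\<close> plus a term of order
  \<open>s\<^sup>2\<close>. Dividing by \<open>s\<close> and letting it tend to 0 leaves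
  \<open>0 \<le> d\<close>: \<open>- z0\<close> is a subgradient at \<open>z0\<close>.\<close>

lemma epigraph_minimum_subgradient:
  fixes E :: "('b::real_inner \<times> real) set"
  assumes "convex E" and "(z0, t0) \<in> E" and "(z, t) \<in> E"
    and min: "\<And>z t. (z, t) \<in> E \<Longrightarrow> t0 + (norm z0)\<^sup>2 / 2 \<le> t + (norm z)\<^sup>2 / 2"
  shows "t0 \<le> t + inner z0 (z - z0)"
proof -
  define d where "d = t - t0 + inner z0 (z - z0)"
  have "0 \<le> d + s * ((norm (z - z0))\<^sup>2 / 2)" if s: "0 < s" "s < 1" for s
  proof -
    have "(1 - s) *\<^sub>R (z0, t0) + s *\<^sub>R (z, t) \<in> E"
      by (rule convexD[OF assms(1)]) (use assms s in auto)
    then have "((1 - s) *\<^sub>R z0 + s *\<^sub>R z, (1 - s) * t0 + s * t) \<in> E"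
      by simp
    then have "t0 + (norm z0)\<^sup>2 / 2
        \<le> (1 - s) * t0 + s * t + (norm ((1 - s) *\<^sub>R z0 + s *\<^sub>R z))\<^sup>2 / 2"
      by (rule min)
    also have "(1 - s) *\<^sub>R z0 + s *\<^sub>R z = z0 + s *\<^sub>R (z - z0)"
      by (simp add: algebra_simps)
    also have "(norm (z0 + s *\<^sub>R (z - z0)))\<^sup>2
        = (norm z0)\<^sup>2 + 2 * s * inner z0 (z - z0) + s\<^sup>2 * (norm (z - z0))\<^sup>2"
      unfolding power2_norm_eq_inner
      by (simp add: inner_add_left inner_add_right inner_commute power2_eq_square)
    finally have "0 \<le> s * (d + s * ((norm (z - z0))\<^sup>2 / 2))"
      unfolding d_def by (simp add: field_simps power2_eq_square)
    then show ?thesis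
      using s by (simp add: zero_le_mult_iff)
  qed
  then have "\<forall>\<^sub>F s in at_right 0. 0 \<le> d + s * ((norm (z - z0))\<^sup>2 / 2)"
    by (auto intro!: eventually_at_rightI[of _ 1])
  moreover have "((\<lambda>s. d + s * ((norm (z - z0))\<^sup>2 / 2)) \<longlongrightarrow> d + 0 * ((norm (z - z0))\<^sup>2 / 2))
      (at_right 0)"
    by (intro tendsto_intros)
  ultimately have "0 \<le> d + 0 * ((norm (z - z0))\<^sup>2 / 2)"
    by (intro tendsto_lowerbound[of _ _ "at_right 0"]) auto
  then show ?thesis
    by (simp add: d_def)
qed

section \<open>Minty's theorem\<close>

text \<open>This is surjectivity of identity plus operator at the single value 0; scaling and
  translating the graph yields the rest.\<close>

lemma minty_graph:
  fixes G :: "('a::{real_inner, complete_space} \<times> 'a) set"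
  assumes mono: "\<And>x v y w. (x, v) \<in> G \<Longrightarrow> (y, w) \<in> G \<Longrightarrow> 0 \<le> inner (x - y) (v - w)"
    and max: "\<And>x v. (\<And>y w. (y, w) \<in> G \<Longrightarrow> 0 \<le> inner (x - y) (v - w)) \<Longrightarrow> (x, v) \<in> G"
  obtains p where "(p, - p) \<in> G"
proof -
  \<comment> \<open>The epigraph of the Fitzpatrick function, written as an intersection of
    half-spaces so that closedness and convexity are immediate.\<close>
  define E :: "(('a \<times> 'a) \<times> real) set" where
    "E = (\<Inter>(y, w)\<in>G. {e. inner ((w, y), -1) e \<le> inner y w})"
  have E_iff: "((x, v), t) \<in> E \<longleftrightarrow> (\<forall>(y, w)\<in>G. inner x w + inner y v - inner y w \<le> t)" for x v t
    unfolding E_def by (auto simp: inner_commute algebra_simps)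
  have "closed E"
    unfolding E_def
    by (auto simp del: inner_Pair intro!: closed_INT closed_halfspace_le)
  have "convex E"
    unfolding E_def by (auto intro!: convex_INT convex_halfspace_le)
  have graph_in_E: "((x, v), inner x v) \<in> E" if "(x, v) \<in> G" for x v
    unfolding E_iff using mono[OF that] by (fastforce simp: algebra_simps inner_commute)
  have "G \<noteq> {}"
    using max[of 0 0] by auto
  then have "E \<noteq> {}"
    using graph_in_E by fastforce
  \<comment> \<open>The supremand equals \<open>inner x v - inner (x - y) (v - w)\<close>. On the
    graph take \<open>(x, v)\<close> itself; off it, maximality supplies a pair with negative inner
    product.\<close>
  have fitzpatrick: "inner x v \<le> t" if "((x, v), t) \<in> E" for x v t
  proof (cases "(x, v) \<in> G")
    case True
    then show ?thesis
      using that unfolding E_iff by fastforce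
  next
    case False
    then obtain y w where yw: "(y, w) \<in> G" "inner (x - y) (v - w) < 0"
      using max[of x v] by (meson not_le)
    then have "inner x w + inner y v - inner y w \<le> t"
      using that unfolding E_iff by fastforce
    with yw show ?thesis
      by (simp add: algebra_simps inner_commute)
  qed
  have square: "(norm (x + v))\<^sup>2 = (norm (x, v))\<^sup>2 + 2 * inner x v" for x v :: 'a
    by (simp add: power2_norm_eq_inner algebra_simps inner_commute)
  have lower: "0 \<le> t + (norm z)\<^sup>2 / 2" if "(z, t) \<in> E" for z t
  proof (cases z)
    case (Pair x v)
    then have "0 \<le> inner x v + (norm z)\<^sup>2 / 2"
      using square[of x v] zero_le_power2[of "norm (x + v)"] by simp
    with fitzpatrick[of x v t] that Pair show ?thesis
      by simp
  qed
  obtain z0 t0 where z0: "(z0, t0) \<in> E"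
    and min: "\<And>z t. (z, t) \<in> E \<Longrightarrow> t0 + (norm z0)\<^sup>2 / 2 \<le> t + (norm z)\<^sup>2 / 2"
    using epigraph_regularised_minimum[OF \<open>closed E\<close> \<open>convex E\<close> \<open>E \<noteq> {}\<close> lower] by metis
  obtain x v where xv: "z0 = (x, v)"
    by fastforce
  \<comment> \<open>The function is at least \<open>inner x v\<close> at the minimiser and at most
    \<open>inner y w\<close> on the graph; the subgradient inequality between these bounds
    rearranges to the claim.\<close>
  have key: "(norm (x + v))\<^sup>2 \<le> inner (- v - y) (- x - w)" if "(y, w) \<in> G" for y w
  proof -
    have "inner x v \<le> t0"
      using fitzpatrick z0 xv by simp
    also have "t0 \<le> inner y w + inner z0 ((y, w) - z0)"
      by (rule epigraph_minimum_subgradient[OF \<open>convex E\<close> z0 graph_in_E[OF that] min])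
    finally show ?thesis
      unfolding square xv
      by (simp add: power2_norm_eq_inner algebra_simps inner_commute)
  qed
  have "(- v, - x) \<in> G"
    by (rule max) (use key in \<open>force intro: order_trans[OF zero_le_power2]\<close>)
  \<comment> \<open>At this graph point the right side of \<open>key\<close> is 0.\<close>
  with key[of "- v" "- x"] have "v = - x"
    by (simp add: add_eq_0_iff)
  with \<open>(- v, - x) \<in> G\<close> have "(x, - x) \<in> G"
    by simp
  then show thesis
    by (rule that)
qed

lemma monotone_opD:
  assumes "monotone_op A" "v \<in> A x" "w \<in> A y"
  shows "0 \<le> inner (x - y) (v - w)"
  using assms unfolding monotone_op_def by blast

text \<open>Adjoining \<open>v\<close> to \<open>A x\<close> gives a monotone operator above
  \<open>A\<close>, which maximality identifies with \<open>A\<close>.\<close>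

lemma maximal_monotone_memI:
  assumes "maximal_monotone A"
    and rel: "\<And>y w. w \<in> A y \<Longrightarrow> 0 \<le> inner (x - y) (v - w)"
  shows "v \<in> A x"
proof -
  define B where "B = A(x := insert v (A x))"
  have "monotone_op A"
    using assms(1) by (simp add: maximal_monotone_def)
  moreover have "0 \<le> inner (y - x) (w - v)" if "w \<in> A y" for y w
    using rel[OF that] by (simp add: algebra_simps)
  ultimately have "monotone_op B"
    using rel unfolding monotone_op_def B_def by auto
  moreover have "A \<le> B"
    unfolding B_def le_fun_def by auto
  ultimately have "B = A"
    using assms(1) by (simp add: maximal_monotone_def)
  then show ?thesis
    unfolding B_def by (metis fun_upd_same insertI1)
qed

lemma minty:
  fixes A :: "'a::{real_inner, complete_space} \<Rightarrow> 'a set"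
  assumes "maximal_monotone A" and "0 < c"
  obtains p v where "v \<in> A p" "x = p + c *\<^sub>R v"
proof -
  \<comment> \<open>The graph of \<open>c *\<^sub>R A - x\<close> is again maximal monotone, and
    \<open>(p, - p)\<close> in it means that \<open>x\<close> lies in
    \<open>p + c *\<^sub>R A p\<close>.\<close>
  define G where "G = {(y, c *\<^sub>R w - x) | y w. w \<in> A y}"
  have A_mono: "monotone_op A"
    using assms(1) by (simp add: maximal_monotone_def)
  obtain p where "(p, - p) \<in> G"
  proof (rule minty_graph[of G])
    fix y w y' w'
    assume "(y, w) \<in> G" "(y', w') \<in> G"
    then obtain v v' where v: "v \<in> A y" "v' \<in> A y'" "w = c *\<^sub>R v - x" "w' = c *\<^sub>R v' - x"
      unfolding G_def by blast
    then have "w - w' = c *\<^sub>R (v - v')"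
      by (simp add: scaleR_diff_right)
    then have "inner (y - y') (w - w') = c * inner (y - y') (v - v')"
      by simp
    then show "0 \<le> inner (y - y') (w - w')"
      using monotone_opD[OF A_mono v(1,2)] \<open>0 < c\<close> by simp
  next
    fix y w
    assume rel: "\<And>y' w'. (y', w') \<in> G \<Longrightarrow> 0 \<le> inner (y - y') (w - w')"
    have "(1 / c) *\<^sub>R (w + x) \<in> A y"
    proof (rule maximal_monotone_memI[OF assms(1)])
      fix y' w'
      assume "w' \<in> A y'"
      then have "0 \<le> inner (y - y') (w - (c *\<^sub>R w' - x))"
        by (intro rel) (auto simp: G_def)
      also have "w - (c *\<^sub>R w' - x) = c *\<^sub>R ((1 / c) *\<^sub>R (w + x) - w')"
        using \<open>0 < c\<close> by (simp add: algebra_simps)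
      finally show "0 \<le> inner (y - y') ((1 / c) *\<^sub>R (w + x) - w')"
        using \<open>0 < c\<close> by (simp add: zero_le_mult_iff)
    qed
    moreover have "w = c *\<^sub>R ((1 / c) *\<^sub>R (w + x)) - x"
      using \<open>0 < c\<close> by simp
    ultimately show "(y, w) \<in> G"
      unfolding G_def by blast
  qed
  then obtain v where "v \<in> A p" "- p = c *\<^sub>R v - x"
    unfolding G_def by blast
  then show thesis
    by (intro that[of v p]) (auto simp: algebra_simps)
qed

section \<open>Resolvents\<close>

text \<open>Evaluating \<open>the_elem\<close> requires uniqueness: for two solutions
  \<open>c *\<^sub>R (v' - v) = - (p' - p)\<close>, so monotonicity forces
  \<open>p' = p\<close>.\<close>

lemma resolvent_eqI:
  assumes "monotone_op A" and "0 < c" and "v \<in> A p" and "x = p + c *\<^sub>R v"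
  shows "resolvent c A x = p"
proof -
  have "p' = p" if "v' \<in> A p'" "x = p' + c *\<^sub>R v'" for p' v'
  proof -
    have "0 \<le> c * inner (p' - p) (v' - v)"
      using monotone_opD[OF assms(1) that(1) assms(3)] \<open>0 < c\<close> by simp
    also have "\<dots> = inner (p' - p) (c *\<^sub>R v' - c *\<^sub>R v)"
      by (simp add: algebra_simps)
    also have "c *\<^sub>R v' - c *\<^sub>R v = - (p' - p)"
      using that(2) assms(4) by (simp add: algebra_simps)
    finally have "inner (p' - p) (p' - p) \<le> 0"
      unfolding inner_minus_right by linarith
    then show ?thesis
      using inner_gt_zero_iff[of "p' - p"] by (simp add: not_less[symmetric])
  qed
  then have "op_inverse (\<lambda>y. {y + c *\<^sub>R v | v. v \<in> A y}) x = {p}"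
    unfolding op_inverse_def using assms(3,4) by blast
  then show ?thesis
    by (simp add: resolvent_def)
qed

text \<open>Expand the square of \<open>x - q = (p - q) + c *\<^sub>R v\<close>: since 0 lies in
  \<open>A q\<close>, monotonicity makes the cross term nonnegative.\<close>

lemma resolvent_dist_zero_le:
  fixes A :: "'a::{real_inner, complete_space} \<Rightarrow> 'a set"
  assumes "maximal_monotone A" and "0 < c" and "q \<in> op_inverse A 0"
  shows "norm (resolvent c A x - q) \<le> norm (x - q)"
proof -
  have A_mono: "monotone_op A"
    using assms(1) by (simp add: maximal_monotone_def)
  obtain p v where pv: "v \<in> A p" "x = p + c *\<^sub>R v"
    using minty[OF assms(1,2)] by blast
  have "0 \<le> inner (p - q) v"
    using monotone_opD[OF A_mono pv(1), of 0 q] assms(3) by (simp add: op_inverse_def)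
  then have "(norm (p - q))\<^sup>2 \<le> (norm (p - q))\<^sup>2 + 2 * c * inner (p - q) v + (c * norm v)\<^sup>2"
    using \<open>0 < c\<close> by simp
  also have "\<dots> = (norm ((p - q) + c *\<^sub>R v))\<^sup>2"
    by (simp only: power_mult_distrib power2_norm_eq_inner)
      (simp add: inner_add_left inner_add_right inner_commute power2_eq_square)
  also have "(p - q) + c *\<^sub>R v = x - q"
    using pv(2) by simp
  finally show ?thesis
    using resolvent_eqI[OF A_mono assms(2) pv] by simp
qed

section \<open>Rates of convergence and metastability\<close>

lemma rate_of_convergence_to_0_imp_tendsto:
  assumes "rate_of_convergence_to_0 s g"
  shows "s \<longlonglongrightarrow> 0"
proof (rule LIMSEQ_I)
  fix r :: real
  assume "0 < r"
  then obtain k where "1 / (real k + 1) < r"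
    using nat_approx_posE by (metis of_nat_Suc add.commute)
  then show "\<exists>no. \<forall>n\<ge>no. norm (s n - 0) < r"
    using assms unfolding rate_of_convergence_to_0_def
    by (metis diff_zero le_less_trans real_norm_def)
qed

text \<open>The triangle inequality through \<open>z (i + 1)\<close> and \<open>z (j + 1)\<close>
  splits the error as 1/(2k+2) + 2/(4k+4) = 1/(k+1).\<close>

lemma rate_of_metastability_shift:
  assumes rate: "rate_of_convergence_to_0 (\<lambda>n. norm (z (n + 1) - y n)) g"
    and meta: "rate_of_metastability z \<rho>"
  shows "rate_of_metastability y (rho_tilde g \<rho>)"
  unfolding rate_of_metastability_def
proof (intro allI)
  fix k f
  define M where "M = g (4 * k + 3)"
  obtain n where n: "n \<le> \<rho> (2 * k + 1) (\<lambda>m. ftilde f M m + 1)"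
    and close: "\<And>i j. i \<in> {n..ftilde f M n + 1} \<Longrightarrow> j \<in> {n..ftilde f M n + 1} \<Longrightarrow>
      norm (z i - z j) \<le> 1 / (real (2 * k + 1) + 1)"
    using meta unfolding rate_of_metastability_def by blast
  have near: "norm (z (i + 1) - y i) \<le> 1 / (real (4 * k + 3) + 1)" if "M \<le> i" for i
    using rate that unfolding rate_of_convergence_to_0_def M_def by fastforce
  show "\<exists>n\<le>rho_tilde g \<rho> k f. \<forall>i\<in>{n..f n}. \<forall>j\<in>{n..f n}.
      norm (y i - y j) \<le> 1 / (real k + 1)"
  proof (intro exI[of _ "max n M"] conjI ballI)
    show "max n M \<le> rho_tilde g \<rho> k f"
      using n by (auto simp: rho_tilde_def M_def)
  next
    fix i j
    assume ij: "i \<in> {max n M..f (max n M)}" "j \<in> {max n M..f (max n M)}"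
    \<comment> \<open>The added 1 in the counterfunction makes room for the shifted indices
      \<open>i + 1\<close> and \<open>j + 1\<close>.\<close>
    then have "norm (z (i + 1) - z (j + 1)) \<le> 1 / (real (2 * k + 1) + 1)"
      by (intro close) (auto simp: ftilde_def)
    moreover have "norm (z (i + 1) - y i) \<le> 1 / (real (4 * k + 3) + 1)"
      "norm (z (j + 1) - y j) \<le> 1 / (real (4 * k + 3) + 1)"
      using near ij by auto
    moreover have "norm (y i - y j) \<le> norm (z (i + 1) - z (j + 1))
        + norm (z (i + 1) - y i) + norm (z (j + 1) - y j)"
      by norm
    moreover have "1 / (real (2 * k + 1) + 1) + 2 * (1 / (real (4 * k + 3) + 1))
        = 1 / (real k + 1)"
      by (simp add: divide_simps) (simp add: algebra_simps)
    ultimately show "norm (y i - y j) \<le> 1 / (real k + 1)"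
      by linarith
  qed
qed

lemma tendsto_parity_interleave:
  assumes "a \<longlonglongrightarrow> l" and "b \<longlonglongrightarrow> l"
  shows "(\<lambda>n. if even n then a (n div 2) else b (n div 2)) \<longlonglongrightarrow> l"
proof -
  have half: "filterlim (\<lambda>n::nat. n div 2) sequentially sequentially"
    unfolding filterlim_at_top
  proof
    fix K :: nat
    show "\<forall>\<^sub>F n in sequentially. K \<le> n div 2"
      using eventually_ge_at_top[of "2 * K"] by eventually_elim simp
  qed
  show ?thesis
    using filterlim_compose[OF assms(1) half] filterlim_compose[OF assms(2) half]
    by (intro filterlim_If) (auto intro: tendsto_mono[OF inf_le1])
qed

section \<open>Comparison of the two iterations\<close>

theorem proposition3p11:
  fixes A' B' A B :: "'a::{real_inner, complete_space} \<Rightarrow> 'a set"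
    and S :: "'a set"
    and u z0 x0 x :: 'a
    and \<alpha>' lam' \<beta>' \<mu>' \<alpha> lam \<beta> \<mu> :: "nat \<Rightarrow> real"
    and z y :: "nat \<Rightarrow> 'a"
  assumes "maximal_monotone A'" and "maximal_monotone B'"
    and "S = op_inverse A' 0 \<inter> op_inverse B' 0" and "S \<noteq> {}"
    and "\<And>n. \<alpha>' n \<in> {0<..<1}" and "\<And>n. lam' n \<in> {0<..<1}"
    and "\<And>n. \<beta>' n > 0" and "\<And>n. \<mu>' n > 0"
    and "z 0 = z0"
    and "\<And>n. z (2 * n + 1) = \<alpha>' n *\<^sub>R u + (1 - \<alpha>' n) *\<^sub>R resolvent (\<beta>' n) A' (z (2 * n))"
    and "\<And>n. z (2 * n + 2) = lam' n *\<^sub>R u + (1 - lam' n) *\<^sub>R resolvent (\<mu>' n) B' (z (2 * n + 1))"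
    and "z \<longlonglongrightarrow> x"
    and "A = B'" and "B = A'"
    and "\<And>n. \<alpha> n = \<alpha>' n" and "\<And>n. lam n = lam' n"
    and "\<And>n. \<beta> n = \<mu>' n" and "\<And>n. \<mu> n = \<beta>' (n + 1)"
    and "x0 = resolvent (\<beta>' 0) A' z0"
    and "y 0 = x0"
    and "\<And>n. y (2 * n + 1) = resolvent (\<beta> n) A (\<alpha> n *\<^sub>R u + (1 - \<alpha> n) *\<^sub>R y (2 * n))"
    and "\<And>n. y (2 * n + 2) = resolvent (\<mu> n) B (lam n *\<^sub>R u + (1 - lam n) *\<^sub>R y (2 * n + 1))"
  shows "(\<alpha>' \<longlonglongrightarrow> 0 \<and> lam' \<longlonglongrightarrow> 0 \<longrightarrow> y \<longlonglongrightarrow> x) \<and>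
    (\<forall>a l N.
       rate_of_convergence_to_0 \<alpha>' a \<and> rate_of_convergence_to_0 lam' l \<and>
       (\<exists>q\<in>S. real N \<ge> Max {norm (u - q), norm (x0 - q), norm q}) \<longrightarrow>
         (\<lambda>n. norm (z (n + 1) - y n)) \<longlonglongrightarrow> 0 \<and>
         rate_of_convergence_to_0 (\<lambda>n. norm (z (n + 1) - y n)) (gamma_rate N a l) \<and>
         (\<forall>\<rho>. rate_of_metastability z \<rho> \<longrightarrow>
               rate_of_metastability y (rho_tilde (gamma_rate N a l) \<rho>)))"
proof -
  note A'_max = assms(1) and B'_max = assms(2) and S_eq = assms(3)
  note \<alpha>_range = assms(5) and lam_range = assms(6) and \<beta>_pos = assms(7) and \<mu>_pos = assms(8)
  note z_odd = assms(10) and z_even = assms(11) and z_lim = assms(12)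
  define c where "c n = (if even n then \<alpha>' (n div 2) else lam' (n div 2))" for n
  have c_range: "0 < c n" "c n < 1" for n
    using \<alpha>_range lam_range by (auto simp: c_def)

  \<comment> \<open>Each resolvent argument in the recursion for \<open>y\<close> is the next term
    of \<open>z\<close>; the shift \<open>\<mu> n = \<beta>' (n + 1)\<close> aligns the
    parameters.\<close>
  have y_resolvent: "y (2 * n) = resolvent (\<beta>' n) A' (z (2 * n)) \<and>
      y (2 * n + 1) = resolvent (\<mu>' n) B' (z (2 * n + 1))" for n
  proof (induction n)
    case 0
    then show ?case
      using assms(9,19,20) assms(21)[of 0] z_odd[of 0] by (simp add: assms(13-18))
  next
    case (Suc n)
    then have "y (2 * n + 2) = resolvent (\<beta>' (n + 1)) A' (z (2 * n + 2))"
      using assms(22)[of n] z_even[of n] by (simp add: assms(13-18))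
    then show ?case
      using assms(21)[of "Suc n"] z_odd[of "Suc n"] by (simp add: assms(13-18))
  qed
  have z_step: "z (n + 1) = c n *\<^sub>R u + (1 - c n) *\<^sub>R y n" for n
  proof (cases "even n")
    case True
    then show ?thesis
      using z_odd[of "n div 2"] y_resolvent[of "n div 2"] by (simp add: c_def)
  next
    case False
    then have "n = 2 * (n div 2) + 1"
      by simp
    then show ?thesis
      using z_even[of "n div 2"] y_resolvent[of "n div 2"] False by (simp add: c_def)
  qed
  have diff_eq: "z (n + 1) - y n = c n *\<^sub>R (u - y n)" for n
    unfolding z_step by (simp add: algebra_simps)

  have limit: "y \<longlonglongrightarrow> x" if lims: "\<alpha>' \<longlonglongrightarrow> 0" "lam' \<longlonglongrightarrow> 0"
  proof -
    have "c \<longlonglongrightarrow> 0"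
      using tendsto_parity_interleave[OF lims] by (simp add: c_def[abs_def])
    moreover have "(\<lambda>n. z (n + 1)) \<longlonglongrightarrow> x"
      using z_lim LIMSEQ_ignore_initial_segment by blast
    \<comment> \<open>Solving \<open>z_step\<close> for \<open>y n\<close>, possible as
      \<open>c n < 1\<close>, expresses it through convergent sequences.\<close>
    ultimately have "(\<lambda>n. inverse (1 - c n) *\<^sub>R (z (n + 1) - c n *\<^sub>R u))
        \<longlonglongrightarrow> inverse (1 - 0) *\<^sub>R (x - 0 *\<^sub>R u)"
      by (intro tendsto_intros) auto
    moreover have "inverse (1 - c n) *\<^sub>R (z (n + 1) - c n *\<^sub>R u) = y n" for n
      using c_range(2)[of n] unfolding z_step by simp
    ultimately show ?thesis
      by simp
  qed

  have rate: "rate_of_convergence_to_0 (\<lambda>n. norm (z (n + 1) - y n)) (gamma_rate N a l)"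
    if a: "rate_of_convergence_to_0 \<alpha>' a" and l: "rate_of_convergence_to_0 lam' l"
      and q: "q \<in> S" and N: "real N \<ge> Max {norm (u - q), norm (x0 - q), norm q}" for a l N q
  proof -
    have uq: "norm (u - q) \<le> N" and xq: "norm (x0 - q) \<le> N"
      using N by auto
    \<comment> \<open>The bound passes from \<open>u\<close> and \<open>y n\<close> to their convex
      combination \<open>z (n + 1)\<close>, then through the resolvent to
      \<open>y (n + 1)\<close>.\<close>
    have yq: "norm (y n - q) \<le> N" for n
    proof (induction n)
      case 0
      then show ?case
        using xq assms(20) by simp
    next
      case (Suc n)
      have "norm (y (Suc n) - q) \<le> norm (z (Suc n) - q)"
      proof (cases "even (Suc n)")
        case True
        then obtain m where "Suc n = 2 * m"
          by (rule evenE)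
        then show ?thesis
          using y_resolvent[of m] resolvent_dist_zero_le[OF A'_max \<beta>_pos] q S_eq by simp
      next
        case False
        then obtain m where "Suc n = 2 * m + 1"
          by (rule oddE)
        then show ?thesis
          using y_resolvent[of m] resolvent_dist_zero_le[OF B'_max \<mu>_pos] q S_eq by simp
      qed
      also have "z (Suc n) - q = c n *\<^sub>R (u - q) + (1 - c n) *\<^sub>R (y n - q)"
        using z_step[of n] by (simp add: algebra_simps)
      also have "norm \<dots> \<le> c n * norm (u - q) + (1 - c n) * norm (y n - q)"
        by (rule order_trans[OF norm_triangle_ineq]) (use c_range[of n] in simp)
      also have "\<dots> \<le> N"
        by (rule convex_bound_le) (use uq Suc.IH c_range[of n] in auto)
      finally show ?case .
    qed
    show ?thesis
      unfolding rate_of_convergence_to_0_def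
    proof (intro allI impI)
      fix k n
      assume n: "gamma_rate N a l k \<le> n"
      let ?K = "2 * N * (k + 1) - 1"
      have "norm (u - y n) \<le> norm (u - q) + norm (y n - q)"
        by norm
      then have uy: "norm (u - y n) \<le> 2 * real N"
        using uq yq[of n] by simp
      \<comment> \<open>The factor 2 in \<open>gamma_rate\<close> compensates for the halved
        index.\<close>
      have "max (a ?K) (l ?K) \<le> n div 2"
        using n unfolding gamma_rate_def shifted_rate_def by linarith
      then have "\<bar>\<alpha>' (n div 2)\<bar> \<le> 1 / (real ?K + 1)" "\<bar>lam' (n div 2)\<bar> \<le> 1 / (real ?K + 1)"
        using a l unfolding rate_of_convergence_to_0_def by auto
      then have "c n \<le> 1 / (real ?K + 1)"
        by (auto simp: c_def)
      then have "c n * norm (u - y n) \<le> 1 / (real ?K + 1) * (2 * real N)"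
        by (intro mult_mono uy) auto
      \<comment> \<open>For positive \<open>N\<close> the subtracted 1 is restored exactly; for
        \<open>N = 0\<close> the left side is 0.\<close>
      also have "\<dots> \<le> 1 / (real k + 1)"
      proof (cases "N = 0")
        case False
        then have "1 \<le> 2 * N * (k + 1)"
          by simp
        then have "real ?K + 1 = 2 * real N * (real k + 1)"
          by (subst of_nat_diff) (auto simp: algebra_simps)
        with False show ?thesis
          by simp
      qed simp
      finally show "\<bar>norm (z (n + 1) - y n)\<bar> \<le> 1 / (real k + 1)"
        unfolding diff_eq using c_range(1)[of n] by simp
    qed
  qed

  show ?thesis
    using limit rate rate_of_convergence_to_0_imp_tendsto rate_of_metastability_shift by blast
qed

end
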